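(* Let $(X,\langle\cdot|\cdot\rangle)$ be a complex Hilbert space and let $x,y\in X\setminus\{0\}$. The law of cosines $$\|x-y\|^2=\|x\|^2+\|y\|^2-2\,\|x\|\,\|y\|\cos(\angle(x,y))$$ holds if and only if the angle $\angle(x,y)$ is real, i.e. if and only if $\langle x|y\rangle\in\mathbb R$.
   Context: A complex Hilbert space is a complete complex inner product space; the inner product is homogeneous over $\mathbb C$ in the first component, conjugate symmetric, positive definite and additive, and $\|x\|=\sqrt{\langle x|x\rangle}$. For $x,y\in X\setminus\{0\}$ the angle is $\angle(x,y):=\arccos\big(\langle x|y\rangle/(\|x\|\,\|y\|)\big)$, where $\arccos:\mathcal B\to\mathcal A$ is the inverse of the homeomorphism $\cos:\mathcal A\to\mathcal B$ obtained by restricting the complex cosine, with $\mathcal A:=\{a+ib\mid 0<a<\pi,\ b\in\mathbb R\}\cup\{0,\pi\}$ and $\mathcal B:=\mathbb C\setminus\{r\in\mathbb R\mid r<-1\text{ or }r>1\}$. *)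

theory Defs
  imports "HOL-Analysis.Analysis"
begin

section \<open>Complex Hilbert spaces\<close>

text \<open>
  The inner product is linear in the first argument. The vector space is a whole
  type \<^typ>\<open>'a\<close>, with an explicit scalar multiplication by complex numbers.
\<close>

locale complex_inner_product_space = vector_space scale
  for scale :: "complex \<Rightarrow> 'a::ab_group_add \<Rightarrow> 'a" +
  fixes ip :: "'a \<Rightarrow> 'a \<Rightarrow> complex"
  assumes ip_scale_left: "ip (scale c x) y = c * ip x y"
    and ip_commute: "ip x y = cnj (ip y x)"
    and ip_pos_def: "x \<noteq> 0 \<Longrightarrow> ip x x \<in> \<real> \<and> 0 < Re (ip x x)"
    and ip_add_left: "ip (x + y) z = ip x z + ip y z"

definition ip_norm :: "('a \<Rightarrow> 'a \<Rightarrow> complex) \<Rightarrow> 'a \<Rightarrow> real"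
  where "ip_norm ip x = sqrt (Re (ip x x))"

context complex_inner_product_space
begin

lemma ip_zero_left [simp]: "ip 0 y = 0"
  using ip_add_left [of 0 0 y] by simp

lemma ip_diff_left: "ip (x - y) z = ip x z - ip y z"
  using ip_add_left [of "x - y" y z] by simp

lemma ip_add_right: "ip x (y + z) = ip x y + ip x z"
  by (metis complex_cnj_add ip_add_left ip_commute)

lemma ip_diff_right: "ip x (y - z) = ip x y - ip x z"
  by (metis complex_cnj_diff ip_diff_left ip_commute)

lemma ip_zero_right [simp]: "ip x 0 = 0"
  using ip_add_right [of x 0 0] by simp

lemma ip_scale_right: "ip x (scale c y) = cnj c * ip x y"
  by (metis complex_cnj_mult ip_commute ip_scale_left)

lemma ip_self_real: "ip x x \<in> \<real>"
  using ip_pos_def [of x] by (cases "x = 0") auto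

lemma ip_self_nonneg: "0 \<le> Re (ip x x)"
  using ip_pos_def [of x] by (cases "x = 0") auto

lemma ip_norm_nonneg: "0 \<le> ip_norm ip x"
  by (simp add: ip_norm_def ip_self_nonneg)

lemma ip_norm_eq_0: "ip_norm ip x = 0 \<longleftrightarrow> x = 0"
  using ip_pos_def [of x] by (cases "x = 0") (auto simp: ip_norm_def)

lemma ip_norm_square: "(ip_norm ip x)\<^sup>2 = Re (ip x x)"
  by (simp add: ip_norm_def ip_self_nonneg)

lemma ip_self_eq: "ip x x = of_real ((ip_norm ip x)\<^sup>2)"
  using ip_self_real [of x] by (simp add: ip_norm_square del: of_real_power)

lemma ip_Cauchy_Schwarz: "cmod (ip x y) \<le> ip_norm ip x * ip_norm ip y"
proof (cases "y = 0")
  case True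
  then show ?thesis
    by (simp add: ip_norm_def)
next
  case False
  define N where "N = Re (ip y y)"
  have N: "N > 0"
    using ip_pos_def [OF False] by (simp add: N_def)
  have yy: "ip y y = of_real N"
    using ip_self_eq [of y] by (simp only: N_def ip_norm_square)
  define c where "c = ip x y / of_real N"
  have yx: "ip y x = cnj (ip x y)"
    by (rule ip_commute)
  have cy: "cnj c * ip x y = of_real ((cmod (ip x y))\<^sup>2 / N)"
    using complex_norm_square [of "ip x y"] by (simp add: c_def mult.commute)
  have cN: "c * of_real N = ip x y"
    using N by (simp add: c_def)
  have "ip (x - scale c y) (x - scale c y) = ip x x - cnj c * ip x y"
  proof -
    have "cnj c * of_real N = ip y x"
      using arg_cong [OF cN, of cnj] yx by simp
    then have "c * (ip y x - cnj c * ip y y) = 0"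
      by (simp add: yy)
    moreover have "ip (x - scale c y) (x - scale c y)
        = ip x x - cnj c * ip x y - c * (ip y x - cnj c * ip y y)"
      unfolding ip_diff_left ip_diff_right ip_scale_left ip_scale_right
      by (simp add: algebra_simps)
    ultimately show ?thesis
      by simp
  qed
  then have "0 \<le> Re (ip x x) - (cmod (ip x y))\<^sup>2 / N"
    using ip_self_nonneg [of "x - scale c y"]
    by (simp only: cy minus_complex.sel Re_complex_of_real)
  then have "(cmod (ip x y))\<^sup>2 \<le> Re (ip x x) * N"
    using N by (simp add: pos_divide_le_eq)
  then have "(cmod (ip x y))\<^sup>2 \<le> (ip_norm ip x * ip_norm ip y)\<^sup>2"
    by (simp add: power_mult_distrib ip_norm_square N_def)
  then show ?thesis
    by (rule power2_le_imp_le) (simp add: ip_norm_nonneg)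
qed

lemma ip_norm_triangle: "ip_norm ip (x + y) \<le> ip_norm ip x + ip_norm ip y"
proof (rule power2_le_imp_le)
  have "Re (ip x y) \<le> ip_norm ip x * ip_norm ip y"
    using complex_Re_le_cmod ip_Cauchy_Schwarz order_trans by blast
  moreover have "Re (ip y x) = Re (ip x y)"
    by (metis cnj.sel(1) ip_commute)
  ultimately show "(ip_norm ip (x + y))\<^sup>2 \<le> (ip_norm ip x + ip_norm ip y)\<^sup>2"
    by (simp add: ip_norm_square ip_add_left ip_add_right power2_sum)
qed (simp add: ip_norm_nonneg)

lemma ip_norm_minus_commute: "ip_norm ip (x - y) = ip_norm ip (y - x)"
  by (simp add: ip_norm_def ip_diff_left ip_diff_right)

sublocale ip_metric: Metric_space UNIV "\<lambda>x y. ip_norm ip (x - y)"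
proof
  show "ip_norm ip (x - z) \<le> ip_norm ip (x - y) + ip_norm ip (y - z)" for x y z
    using ip_norm_triangle [of "x - y" "y - z"] by simp
qed (use ip_norm_minus_commute in \<open>auto simp: ip_norm_nonneg ip_norm_eq_0\<close>)

end

locale complex_hilbert_space = complex_inner_product_space scale ip
  for scale :: "complex \<Rightarrow> 'a::ab_group_add \<Rightarrow> 'a" and ip :: "'a \<Rightarrow> 'a \<Rightarrow> complex" +
  assumes complete: "Metric_space.mcomplete UNIV (\<lambda>x y. ip_norm ip (x - y))"

lemma complex_hilbert_space_complex: "complex_hilbert_space (*) (\<lambda>x y. x * cnj y)"
proof -
  have sp: "complex_inner_product_space (*) (\<lambda>x y. x * cnj y)"
  proof
    show "x * cnj x \<in> \<real> \<and> 0 < Re (x * cnj x)" if "x \<noteq> 0" for x :: complex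
      using that by (simp add: complex_mult_cnj complex_neq_0 del: of_real_add of_real_power)
  qed (auto simp: algebra_simps)
  have "ip_norm (\<lambda>x y. x * cnj y) = cmod"
    by (intro ext) (simp add: ip_norm_def norm_complex_def power2_eq_square)
  then have "(\<lambda>x y. ip_norm (\<lambda>x y. x * cnj y) (x - y)) = (dist :: complex \<Rightarrow> _)"
    by (intro ext) (simp add: dist_norm)
  then have "Metric_space.mcomplete UNIV (\<lambda>x y. ip_norm (\<lambda>x y. x * cnj y) (x - y :: complex))"
    by (simp add: complete_UNIV)
  then show ?thesis
    using sp by (simp add: complex_hilbert_space_def complex_hilbert_space_axioms_def)
qed


section \<open>The complex arccosine and the angle\<close>

text \<open>
  The complex cosine maps \<open>cos_strip\<close> bijectively onto \<open>slit_plane\<close>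
  (\<open>bij_betw_cos_strip\<close>), so \<open>complex_arccos\<close> is meaningful exactly on
  \<open>slit_plane\<close>. By the Cauchy-Schwarz inequality the argument in \<open>ip_angle\<close>
  lies there for nonzero vectors (\<open>angle_arg_in_slit_plane\<close>).
\<close>

definition cos_strip :: "complex set"
  where "cos_strip = {z. 0 < Re z \<and> Re z < pi} \<union> {0, of_real pi}"

definition slit_plane :: "complex set"
  where "slit_plane = UNIV - of_real ` {r::real. r < -1 \<or> 1 < r}"

definition complex_arccos :: "complex \<Rightarrow> complex"
  where "complex_arccos = the_inv_into cos_strip cos"

definition ip_angle :: "('a \<Rightarrow> 'a \<Rightarrow> complex) \<Rightarrow> 'a \<Rightarrow> 'a \<Rightarrow> complex"
  where "ip_angle ip x y = complex_arccos (ip x y / of_real (ip_norm ip x * ip_norm ip y))"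

lemma Arccos_cos_strip: "z \<in> cos_strip \<Longrightarrow> Arccos (cos z) = z"
  by (rule Arccos_cos) (auto simp: cos_strip_def)

lemma Arccos_in_cos_strip:
  assumes "w \<in> slit_plane"
  shows "Arccos w \<in> cos_strip"
proof (cases "w = 1 \<or> w = -1")
  case True
  then show ?thesis
    by (auto simp: Arccos_minus1 cos_strip_def)
next
  case False
  have nr: "Im w = 0 \<Longrightarrow> \<bar>Re w\<bar> < 1"
  proof -
    assume im: "Im w = 0"
    then have w: "w = of_real (Re w)"
      by (simp add: complex_eq_iff)
    then have "\<not> (Re w < -1 \<or> 1 < Re w)"
      using assms unfolding slit_plane_def by blast
    moreover have "Re w \<noteq> 1" "Re w \<noteq> -1"
      using False im by (auto simp: complex_eq_iff)
    ultimately show ?thesis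
      by linarith
  qed
  let ?z = "w + \<i> * csqrt (1 - w\<^sup>2)"
  have "Im ?z \<noteq> 0"
    using isCont_Arccos_lemma nr by blast
  moreover have "0 \<le> Im ?z"
  proof (rule ccontr)
    assume neg: "\<not> 0 \<le> Im ?z"
    define v where "v = w - \<i> * csqrt (1 - w\<^sup>2)"
    have "?z * v = w\<^sup>2 + (csqrt (1 - w\<^sup>2))\<^sup>2"
      by (simp add: v_def algebra_simps power2_eq_square)
    then have "?z * v = 1"
      by simp
    then have v: "v = inverse ?z"
      by (rule inverse_unique [symmetric])
    have "0 < (Re ?z)\<^sup>2 + (Im ?z)\<^sup>2"
      using neg by (simp only: sum_power2_gt_zero_iff) linarith
    then have "0 < Im v"
      unfolding v inverse_complex.sel using neg by (intro divide_pos_pos) linarith+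
    moreover have "Im ?z - Im v = 2 * Re (csqrt (1 - w\<^sup>2))"
      by (simp add: v_def)
    moreover have "0 \<le> Re (csqrt (1 - w\<^sup>2))"
      by (rule Re_csqrt)
    ultimately show False
      using neg by linarith
  qed
  ultimately have "0 < Im ?z"
    by linarith
  then have "0 < Re (Arccos w) \<and> Re (Arccos w) < pi"
    unfolding Re_Arccos by (rule Im_Ln_pos_lt_imp)
  then show ?thesis
    by (simp add: cos_strip_def)
qed

lemma cos_in_slit_plane:
  assumes "z \<in> cos_strip"
  shows "cos z \<in> slit_plane"
proof (cases "z = 0 \<or> z = of_real pi")
  case True
  then have "cos z = of_real 1 \<or> cos z = of_real (-1)"
    by auto
  then show ?thesis
    unfolding slit_plane_def using of_real_eq_iff [where 'a = complex]
    by (auto simp del: of_real_1 of_real_minus)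
next
  case False
  then have z: "0 < Re z" "Re z < pi"
    using assms by (auto simp: cos_strip_def)
  show ?thesis
  proof (rule ccontr)
    assume "cos z \<notin> slit_plane"
    then obtain r :: real where r: "cos z = of_real r" "r < -1 \<or> 1 < r"
      by (auto simp: slit_plane_def)
    then have "sin (Re z) * (exp (- Im z) - exp (Im z)) = 0"
      using Im_cos [of z] by simp
    moreover have "sin (Re z) > 0"
      using z by (rule sin_gt_zero)
    ultimately have "Im z = 0"
      by simp
    then have "r = cos (Re z)"
      using Re_cos [of z] r(1) by simp
    then show False
      using r(2) cos_ge_minus_one [of "Re z"] cos_le_one [of "Re z"] by linarith
  qed
qed

lemma bij_betw_cos_strip: "bij_betw cos cos_strip slit_plane"
  by (rule bij_betw_byWitness [where f' = Arccos])
     (auto simp: Arccos_cos_strip Arccos_in_cos_strip cos_in_slit_plane)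

lemma complex_arccos_eq_Arccos: "w \<in> slit_plane \<Longrightarrow> complex_arccos w = Arccos w"
  unfolding complex_arccos_def
  by (rule the_inv_into_f_eq)
     (use bij_betw_cos_strip in \<open>auto simp: bij_betw_def Arccos_in_cos_strip\<close>)

lemma (in complex_inner_product_space) angle_arg_in_slit_plane:
  assumes "x \<noteq> 0" "y \<noteq> 0"
  shows "ip x y / of_real (ip_norm ip x * ip_norm ip y) \<in> slit_plane"
proof -
  let ?w = "ip x y / of_real (ip_norm ip x * ip_norm ip y)"
  have "0 < ip_norm ip x * ip_norm ip y"
    using assms ip_norm_nonneg ip_norm_eq_0 by (simp add: less_le)
  then have "cmod ?w \<le> 1"
    using ip_Cauchy_Schwarz [of x y] by (simp add: norm_divide del: of_real_mult)
  then show ?thesis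
    by (auto simp: slit_plane_def)
qed

end

theory Submission
  imports Defs
begin

text \<open>Expanding the inner product gives |x - y|^2 = |x|^2 + |y|^2 - 2 Re (ip x y), because ip
  x y and ip y x are conjugate (\<open>ip_norm_diff_square\<close>). On the other side, |x| |y| cos
  (angle) is the full complex number ip x y (\<open>ip_norm_mult_cos_angle\<close>). So the law of
  cosines says exactly that ip x y equals its real part. This matches reality of the angle because
  \<open>complex_arccos\<close> takes real values precisely at the real points of
  \<open>slit_plane\<close> (\<open>ip_angle_real_iff\<close>).\<close>

text \<open>Cosine sends reals to reals; conversely, on [-1, 1] the complex \<open>Arccos\<close>
  agrees with the real \<open>arccos\<close>.\<close>

lemma complex_arccos_real_iff:
  assumes "w \<in> slit_plane"
  shows "complex_arccos w \<in> \<real> \<longleftrightarrow> w \<in> \<real>"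
proof
  assume "complex_arccos w \<in> \<real>"
  then obtain t where "Arccos w = of_real t"
    using complex_arccos_eq_Arccos [OF assms] by (auto elim: Reals_cases)
  then have "w = of_real (cos t)"
    by (metis cos_Arccos cos_of_real)
  then show "w \<in> \<real>"
    by simp
next
  assume "w \<in> \<real>"
  then obtain r where r: "w = of_real r"
    by (rule Reals_cases)
  \<comment> \<open>The slits consist of all reals of modulus above 1.\<close>
  then have "\<bar>r\<bar> \<le> 1"
    using assms by (force simp: slit_plane_def)
  then have "Arccos w = of_real (arccos r)"
    by (simp add: r of_real_arccos)
  then show "complex_arccos w \<in> \<real>"
    by (simp add: complex_arccos_eq_Arccos [OF assms])
qed

context complex_inner_product_space
begin

text \<open>By Cauchy-Schwarz the quotient inside \<open>ip_angle\<close> lies in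
  \<open>slit_plane\<close>, where cosine undoes \<open>complex_arccos\<close>; the nonzero norms
  then cancel.\<close>

lemma ip_norm_mult_cos_angle:
  assumes "x \<noteq> 0" "y \<noteq> 0"
  shows "of_real (ip_norm ip x) * of_real (ip_norm ip y) * cos (ip_angle ip x y) = ip x y"
  using assms angle_arg_in_slit_plane [OF assms]
  by (simp add: ip_angle_def complex_arccos_eq_Arccos ip_norm_eq_0)

text \<open>Dividing by the nonzero real product of the norms does not affect whether ip x y is
  real.\<close>

lemma ip_angle_real_iff:
  assumes "x \<noteq> 0" "y \<noteq> 0"
  shows "ip_angle ip x y \<in> \<real> \<longleftrightarrow> ip x y \<in> \<real>"
proof -
  have "ip_norm ip x * ip_norm ip y \<noteq> 0"
    using assms by (simp add: ip_norm_eq_0)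
  then have "ip x y / of_real (ip_norm ip x * ip_norm ip y) \<in> \<real> \<longleftrightarrow> ip x y \<in> \<real>"
    by (simp add: complex_is_Real_iff Im_divide_of_real del: of_real_mult)
  then show ?thesis
    unfolding ip_angle_def using complex_arccos_real_iff angle_arg_in_slit_plane [OF assms] by blast
qed

lemma ip_norm_diff_square:
  "(ip_norm ip (x - y))\<^sup>2 = (ip_norm ip x)\<^sup>2 + (ip_norm ip y)\<^sup>2 - 2 * Re (ip x y)"
proof -
  have "Re (ip y x) = Re (ip x y)"
    by (metis cnj.sel(1) ip_commute)
  then show ?thesis
    by (simp add: ip_norm_square ip_diff_left ip_diff_right)
qed

end

theorem proposition4p9:
  fixes scale :: "complex \<Rightarrow> 'a::ab_group_add \<Rightarrow> 'a"
    and ip :: "'a \<Rightarrow> 'a \<Rightarrow> complex"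
    and x y :: 'a
  assumes "complex_hilbert_space scale ip"
    and "x \<noteq> 0" and "y \<noteq> 0"
  shows "(complex_of_real ((ip_norm ip (x - y))\<^sup>2)
            = complex_of_real ((ip_norm ip x)\<^sup>2) + complex_of_real ((ip_norm ip y)\<^sup>2)
              - 2 * complex_of_real (ip_norm ip x) * complex_of_real (ip_norm ip y)
                  * cos (ip_angle ip x y)
          \<longleftrightarrow> ip_angle ip x y \<in> \<real>)
         \<and> (ip_angle ip x y \<in> \<real> \<longleftrightarrow> ip x y \<in> \<real>)"
proof -
  interpret complex_hilbert_space scale ip
    by fact
  have "complex_of_real ((ip_norm ip (x - y))\<^sup>2)
      = complex_of_real ((ip_norm ip x)\<^sup>2) + complex_of_real ((ip_norm ip y)\<^sup>2) - 2 * ip x y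
      \<longleftrightarrow> ip x y \<in> \<real>"
    \<comment> \<open>The real parts of both sides now agree automatically; the imaginary parts
      agree iff Im (ip x y) = 0.\<close>
    unfolding ip_norm_diff_square
    by (auto simp: complex_eq_iff complex_is_Real_iff simp del: of_real_power)
  moreover have "2 * complex_of_real (ip_norm ip x) * complex_of_real (ip_norm ip y)
      * cos (ip_angle ip x y) = 2 * ip x y"
    using ip_norm_mult_cos_angle [OF assms(2,3)] by (simp add: mult.assoc)
  ultimately show ?thesis
    using ip_angle_real_iff [OF assms(2,3)] by presburger
qed

end
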